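(* Let $(\mathcal{M},\varphi,\xi,\eta,g)$ be an almost contact complex Riemannian manifold equipped with a Yamabe almost soliton $(g;\vartheta,\lambda)$, where the potential $\vartheta=k\,\xi$ is vertical and is a torse-forming vector field with respect to $g$ with conformal scalar $f$. Then the scalar curvature $\tau$ of $g$ is the sum of the conformal scalar $f$ of $\vartheta$ and the soliton function $\lambda$, i.e. $\tau=f+\lambda$.
   Context: An almost contact complex Riemannian (accR) manifold, also called an almost contact B-metric manifold, $(\mathcal{M},\varphi,\xi,\eta,g)$ is a differentiable (smooth) manifold $\mathcal{M}$ of dimension $2n+1$, $n\geq 1$, with an endomorphism $\varphi$ of the tangent bundle $T\mathcal{M}$, a vector field $\xi$ (the Reeb vector field), a 1-form $\eta$ and a pseudo-Riemannian metric $g$ of signature $(n+1,n)$ such that $$\varphi\xi=0,\quad \varphi^2=-\mathrm{Id}+\eta\otimes\xi,\quad \eta\circ\varphi=0,\quad \eta(\xi)=1,\quad g(\varphi x,\varphi y)=-g(x,y)+\eta(x)\eta(y)$$ for all vector fields $x,y$. Let $\nabla$ be the Levi-Civita connection of $g$. A Yamabe almost soliton generated by $g$, denoted $(g;\vartheta,\lambda)$, consists of a vector field $\vartheta$ (the potential) and a differentiable function $\lambda$ (the soliton function) on $\mathcal{M}$ with $\frac12\mathcal{L}_{\vartheta}g=(\tau-\lambda)g$, where $\mathcal{L}$ is the Lie derivative and $\tau$ is the scalar curvature of $g$. The potential is vertical if $\vartheta=k\,\xi$ for a differentiable function $k$ on $\mathcal{M}$ with $k(p)\neq0$ at every point $p\in\mathcal{M}$.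 A vector field $\vartheta$ is torse-forming (with respect to $g$) if $\nabla_x\vartheta=f\,x+\gamma(x)\vartheta$ for every vector field $x$, where $f$ is a differentiable function (the conformal scalar of $\vartheta$) and $\gamma$ is a 1-form (the generating form of $\vartheta$). *)

theory Defs
  imports "HOL-Analysis.Analysis"
begin

section \<open>Smooth maps between Euclidean spaces\<close>

text \<open>Only meant for open \<open>S\<close>: \<open>C_k_on k S f\<close> says that all iterated directional derivatives of
  \<open>f\<close> of order less than \<open>k\<close> exist and are Frechet differentiable on \<open>S\<close>, and that those of order
  \<open>k\<close> are continuous.\<close>

primrec C_k_on :: "nat \<Rightarrow> 'a::real_normed_vector set \<Rightarrow> ('a \<Rightarrow> 'b::real_normed_vector) \<Rightarrow> bool" where
  "C_k_on 0 S f \<longleftrightarrow> continuous_on S f"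
| "C_k_on (Suc k) S f \<longleftrightarrow>
     (\<forall>x\<in>S. f differentiable (at x)) \<and> (\<forall>v. C_k_on k S (\<lambda>x. frechet_derivative f (at x) v))"

definition smooth_on :: "'a::real_normed_vector set \<Rightarrow> ('a \<Rightarrow> 'b::real_normed_vector) \<Rightarrow> bool" where
  "smooth_on S f \<longleftrightarrow> (\<forall>k. C_k_on k S f)"


section \<open>Smooth manifolds\<close>

text \<open>The points of the manifold are the elements of a type \<open>'m\<close>; the Hausdorff property and second
  countability are supplied by the type classes where the notion is used. A chart is a pair of its
  domain and its coordinate map, with values in a Euclidean space \<open>'e\<close>, so that the dimension of the
  manifold is \<open>DIM('e)\<close>. The atlas need not be maximal.\<close>

type_synonym ('m, 'e) chart = "'m set \<times> ('m \<Rightarrow> 'e)"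

definition smooth_manifold ::
    "('m::{t2_space, second_countable_topology}, 'e::euclidean_space) chart set \<Rightarrow> bool" where
  "smooth_manifold A \<longleftrightarrow>
     (\<Union>(U, \<psi>)\<in>A. U) = UNIV \<and>
     (\<forall>(U, \<psi>)\<in>A. open U \<and> open (\<psi> ` U) \<and> homeomorphism U (\<psi> ` U) \<psi> (inv_into U \<psi>)) \<and>
     (\<forall>(U, \<psi>)\<in>A. \<forall>(V, \<rho>)\<in>A. smooth_on (\<psi> ` (U \<inter> V)) (\<rho> \<circ> inv_into U \<psi>))"

definition smooth_fun :: "('m, 'e::euclidean_space) chart set \<Rightarrow> ('m \<Rightarrow> real) \<Rightarrow> bool" where
  "smooth_fun A f \<longleftrightarrow> (\<forall>(U, \<psi>)\<in>A. smooth_on (\<psi> ` U) (f \<circ> inv_into U \<psi>))"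


section \<open>Tangent vectors and vector fields\<close>

text \<open>Tangent vectors at \<open>p\<close> are the derivations at \<open>p\<close> of the algebra of smooth functions. To make
  equality of tangent vectors the equality of HOL functions, they are set to \<open>0\<close> on functions that are
  not smooth.\<close>

type_synonym 'm tvec = "('m \<Rightarrow> real) \<Rightarrow> real"
type_synonym 'm vfield = "'m \<Rightarrow> 'm tvec"

definition tadd :: "'m tvec \<Rightarrow> 'm tvec \<Rightarrow> 'm tvec" where
  "tadd v w = (\<lambda>f. v f + w f)"

definition tscale :: "real \<Rightarrow> 'm tvec \<Rightarrow> 'm tvec" where
  "tscale c v = (\<lambda>f. c * v f)"

definition tzero :: "'m tvec" where
  "tzero = (\<lambda>f. 0)"

definition tangent_space :: "('m, 'e::euclidean_space) chart set \<Rightarrow> 'm \<Rightarrow> 'm tvec set" where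
  "tangent_space A p = {v.
     (\<forall>f h a b. smooth_fun A f \<longrightarrow> smooth_fun A h \<longrightarrow>
        v (\<lambda>q. a * f q + b * h q) = a * v f + b * v h) \<and>
     (\<forall>f h. smooth_fun A f \<longrightarrow> smooth_fun A h \<longrightarrow> v (\<lambda>q. f q * h q) = f p * v h + h p * v f) \<and>
     (\<forall>f. \<not> smooth_fun A f \<longrightarrow> v f = 0)}"

definition vector_fields :: "('m, 'e::euclidean_space) chart set \<Rightarrow> 'm vfield set" where
  "vector_fields A = {X. (\<forall>p. X p \<in> tangent_space A p) \<and>
     (\<forall>f. smooth_fun A f \<longrightarrow> smooth_fun A (\<lambda>p. X p f))}"

definition vadd :: "'m vfield \<Rightarrow> 'm vfield \<Rightarrow> 'm vfield" where
  "vadd X Y = (\<lambda>p. tadd (X p) (Y p))"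

definition vscale :: "('m \<Rightarrow> real) \<Rightarrow> 'm vfield \<Rightarrow> 'm vfield" where
  "vscale k X = (\<lambda>p. tscale (k p) (X p))"

definition lie_bracket :: "'m vfield \<Rightarrow> 'm vfield \<Rightarrow> 'm vfield" where
  "lie_bracket X Y = (\<lambda>p f. X p (\<lambda>q. Y q f) - Y p (\<lambda>q. X q f))"


section \<open>Tensor fields\<close>

text \<open>Tensor fields are families of (multi)linear maps on the tangent spaces which yield smooth
  objects on smooth vector fields. Their values outside the tangent spaces are irrelevant.\<close>

definition one_form ::
    "('m, 'e::euclidean_space) chart set \<Rightarrow> ('m \<Rightarrow> 'm tvec \<Rightarrow> real) \<Rightarrow> bool" where
  "one_form A \<alpha> \<longleftrightarrow>
     (\<forall>p. \<forall>v\<in>tangent_space A p. \<forall>w\<in>tangent_space A p. \<forall>a b.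
        \<alpha> p (tadd (tscale a v) (tscale b w)) = a * \<alpha> p v + b * \<alpha> p w) \<and>
     (\<forall>X\<in>vector_fields A. smooth_fun A (\<lambda>p. \<alpha> p (X p)))"

definition endomorphism_field ::
    "('m, 'e::euclidean_space) chart set \<Rightarrow> ('m \<Rightarrow> 'm tvec \<Rightarrow> 'm tvec) \<Rightarrow> bool" where
  "endomorphism_field A \<phi> \<longleftrightarrow>
     (\<forall>p. \<forall>v\<in>tangent_space A p. \<phi> p v \<in> tangent_space A p) \<and>
     (\<forall>p. \<forall>v\<in>tangent_space A p. \<forall>w\<in>tangent_space A p. \<forall>a b.
        \<phi> p (tadd (tscale a v) (tscale b w)) = tadd (tscale a (\<phi> p v)) (tscale b (\<phi> p w))) \<and>
     (\<forall>X\<in>vector_fields A. (\<lambda>p. \<phi> p (X p)) \<in> vector_fields A)"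

definition symmetric_2_tensor ::
    "('m, 'e::euclidean_space) chart set \<Rightarrow> ('m \<Rightarrow> 'm tvec \<Rightarrow> 'm tvec \<Rightarrow> real) \<Rightarrow> bool" where
  "symmetric_2_tensor A g \<longleftrightarrow>
     (\<forall>p. \<forall>v\<in>tangent_space A p. \<forall>w\<in>tangent_space A p. g p v w = g p w v) \<and>
     (\<forall>p. \<forall>v\<in>tangent_space A p. \<forall>w\<in>tangent_space A p. \<forall>z\<in>tangent_space A p. \<forall>a b.
        g p (tadd (tscale a v) (tscale b w)) z = a * g p v z + b * g p w z) \<and>
     (\<forall>X\<in>vector_fields A. \<forall>Y\<in>vector_fields A. smooth_fun A (\<lambda>p. g p (X p) (Y p)))"


section \<open>Pseudo-Riemannian metrics, Levi-Civita connection, scalar curvature\<close>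

text \<open>A \<open>g\<close>-orthonormal basis \<open>e 0, \<dots>, e (DIM('e) - 1)\<close> of the tangent space at \<open>p\<close>; linear
  independence follows from orthonormality.\<close>

definition orthonormal_frame ::
    "('m, 'e::euclidean_space) chart set \<Rightarrow> ('m \<Rightarrow> 'm tvec \<Rightarrow> 'm tvec \<Rightarrow> real) \<Rightarrow> 'm \<Rightarrow>
     (nat \<Rightarrow> 'm tvec) \<Rightarrow> bool" where
  "orthonormal_frame A g p e \<longleftrightarrow>
     (\<forall>i<DIM('e). e i \<in> tangent_space A p) \<and>
     (\<forall>i<DIM('e). g p (e i) (e i) = 1 \<or> g p (e i) (e i) = -1) \<and>
     (\<forall>i<DIM('e). \<forall>j<DIM('e). i \<noteq> j \<longrightarrow> g p (e i) (e j) = 0) \<and>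
     (\<forall>v\<in>tangent_space A p. \<exists>c :: nat \<Rightarrow> real. v = (\<lambda>f. \<Sum>i<DIM('e). c i * e i f))"

text \<open>Signature \<open>(r, s)\<close>: \<open>r\<close> positive and \<open>s\<close> negative directions. Nondegeneracy of \<open>g\<close> is
  implied by the existence of an orthonormal basis.\<close>

definition pseudo_riemannian_metric ::
    "('m, 'e::euclidean_space) chart set \<Rightarrow> nat \<Rightarrow> nat \<Rightarrow>
     ('m \<Rightarrow> 'm tvec \<Rightarrow> 'm tvec \<Rightarrow> real) \<Rightarrow> bool" where
  "pseudo_riemannian_metric A r s g \<longleftrightarrow>
     symmetric_2_tensor A g \<and>
     (\<forall>p. \<exists>e. orthonormal_frame A g p e \<and>
        card {i. i < DIM('e) \<and> g p (e i) (e i) = 1} = r \<and>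
        card {i. i < DIM('e) \<and> g p (e i) (e i) = -1} = s)"

text \<open>Connections are written \<open>D X Y\<close> for the covariant derivative of \<open>Y\<close> along \<open>X\<close>; only their
  values on smooth vector fields matter.\<close>

definition affine_connection ::
    "('m, 'e::euclidean_space) chart set \<Rightarrow> ('m vfield \<Rightarrow> 'm vfield \<Rightarrow> 'm vfield) \<Rightarrow> bool" where
  "affine_connection A D \<longleftrightarrow>
     (\<forall>X\<in>vector_fields A. \<forall>Y\<in>vector_fields A. D X Y \<in> vector_fields A) \<and>
     (\<forall>X\<in>vector_fields A. \<forall>Y\<in>vector_fields A. \<forall>Z\<in>vector_fields A.
        D (vadd X Y) Z = vadd (D X Z) (D Y Z) \<and> D X (vadd Y Z) = vadd (D X Y) (D X Z)) \<and>
     (\<forall>X\<in>vector_fields A. \<forall>Y\<in>vector_fields A. \<forall>f. smooth_fun A f \<longrightarrow>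
        D (vscale f X) Y = vscale f (D X Y) \<and>
        D X (vscale f Y) = vadd (vscale (\<lambda>p. X p f) Y) (vscale f (D X Y)))"

definition levi_civita_connection ::
    "('m, 'e::euclidean_space) chart set \<Rightarrow> ('m \<Rightarrow> 'm tvec \<Rightarrow> 'm tvec \<Rightarrow> real) \<Rightarrow>
     ('m vfield \<Rightarrow> 'm vfield \<Rightarrow> 'm vfield) \<Rightarrow> bool" where
  "levi_civita_connection A g D \<longleftrightarrow>
     affine_connection A D \<and>
     (\<forall>X\<in>vector_fields A. \<forall>Y\<in>vector_fields A. \<forall>p f.
        D X Y p f - D Y X p f = lie_bracket X Y p f) \<and>
     (\<forall>X\<in>vector_fields A. \<forall>Y\<in>vector_fields A. \<forall>Z\<in>vector_fields A. \<forall>p.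
        X p (\<lambda>q. g q (Y q) (Z q)) = g p (D X Y p) (Z p) + g p (Y p) (D X Z p))"

definition curvature_field ::
    "('m vfield \<Rightarrow> 'm vfield \<Rightarrow> 'm vfield) \<Rightarrow> 'm vfield \<Rightarrow> 'm vfield \<Rightarrow> 'm vfield \<Rightarrow> 'm vfield" where
  "curvature_field D X Y Z =
     (\<lambda>p f. D X (D Y Z) p f - D Y (D X Z) p f - D (lie_bracket X Y) Z p f)"

text \<open>The value of the curvature at \<open>p\<close> on tangent vectors is obtained by extending these to global
  smooth vector fields; by tensoriality it does not depend on the extensions.\<close>

definition extend_to_field ::
    "('m, 'e::euclidean_space) chart set \<Rightarrow> 'm \<Rightarrow> 'm tvec \<Rightarrow> 'm vfield" where
  "extend_to_field A p v = (SOME X. X \<in> vector_fields A \<and> X p = v)"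

definition curvature_tensor ::
    "('m, 'e::euclidean_space) chart set \<Rightarrow> ('m vfield \<Rightarrow> 'm vfield \<Rightarrow> 'm vfield) \<Rightarrow> 'm \<Rightarrow>
     'm tvec \<Rightarrow> 'm tvec \<Rightarrow> 'm tvec \<Rightarrow> 'm tvec" where
  "curvature_tensor A D p u v w =
     curvature_field D (extend_to_field A p u) (extend_to_field A p v) (extend_to_field A p w) p"

text \<open>The contractions with the inverse of \<open>g\<close> are computed in an orthonormal basis, whose choice does
  not matter: \<open>Ric(v, w)\<close> is the trace of \<open>u \<mapsto> R(u, v)w\<close>, and the scalar curvature is the
  \<open>g\<close>-trace of \<open>Ric\<close>. In this convention round spheres have positive scalar curvature.\<close>

definition some_orthonormal_frame ::
    "('m, 'e::euclidean_space) chart set \<Rightarrow> ('m \<Rightarrow> 'm tvec \<Rightarrow> 'm tvec \<Rightarrow> real) \<Rightarrow> 'm \<Rightarrow>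
     nat \<Rightarrow> 'm tvec" where
  "some_orthonormal_frame A g p = (SOME e. orthonormal_frame A g p e)"

definition ricci_tensor ::
    "('m, 'e::euclidean_space) chart set \<Rightarrow> ('m \<Rightarrow> 'm tvec \<Rightarrow> 'm tvec \<Rightarrow> real) \<Rightarrow>
     ('m vfield \<Rightarrow> 'm vfield \<Rightarrow> 'm vfield) \<Rightarrow> 'm \<Rightarrow> 'm tvec \<Rightarrow> 'm tvec \<Rightarrow> real" where
  "ricci_tensor A g D p v w =
     (let e = some_orthonormal_frame A g p in
      \<Sum>i<DIM('e). g p (e i) (e i) * g p (curvature_tensor A D p (e i) v w) (e i))"

definition scalar_curvature ::
    "('m, 'e::euclidean_space) chart set \<Rightarrow> ('m \<Rightarrow> 'm tvec \<Rightarrow> 'm tvec \<Rightarrow> real) \<Rightarrow>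
     ('m vfield \<Rightarrow> 'm vfield \<Rightarrow> 'm vfield) \<Rightarrow> 'm \<Rightarrow> real" where
  "scalar_curvature A g D p =
     (let e = some_orthonormal_frame A g p in
      \<Sum>j<DIM('e). g p (e j) (e j) * ricci_tensor A g D p (e j) (e j))"

definition lie_derivative_metric ::
    "'m vfield \<Rightarrow> ('m \<Rightarrow> 'm tvec \<Rightarrow> 'm tvec \<Rightarrow> real) \<Rightarrow> 'm vfield \<Rightarrow> 'm vfield \<Rightarrow> 'm \<Rightarrow> real" where
  "lie_derivative_metric V g X Y p =
     V p (\<lambda>q. g q (X q) (Y q)) - g p (lie_bracket V X p) (Y p) - g p (X p) (lie_bracket V Y p)"


section \<open>Almost contact complex Riemannian manifolds, Yamabe solitons, torse-forming fields\<close>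

definition accR_manifold ::
    "('m::{t2_space, second_countable_topology}, 'e::euclidean_space) chart set \<Rightarrow> nat \<Rightarrow>
     ('m \<Rightarrow> 'm tvec \<Rightarrow> 'm tvec) \<Rightarrow> 'm vfield \<Rightarrow> ('m \<Rightarrow> 'm tvec \<Rightarrow> real) \<Rightarrow>
     ('m \<Rightarrow> 'm tvec \<Rightarrow> 'm tvec \<Rightarrow> real) \<Rightarrow> bool" where
  "accR_manifold A n \<phi> \<xi> \<eta> g \<longleftrightarrow>
     n \<ge> 1 \<and> DIM('e) = 2 * n + 1 \<and> smooth_manifold A \<and>
     endomorphism_field A \<phi> \<and> \<xi> \<in> vector_fields A \<and> one_form A \<eta> \<and>
     pseudo_riemannian_metric A (n + 1) n g \<and>
     (\<forall>p. \<phi> p (\<xi> p) = tzero) \<and>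
     (\<forall>X\<in>vector_fields A. \<forall>p.
        \<phi> p (\<phi> p (X p)) = tadd (tscale (-1) (X p)) (tscale (\<eta> p (X p)) (\<xi> p))) \<and>
     (\<forall>X\<in>vector_fields A. \<forall>p. \<eta> p (\<phi> p (X p)) = 0) \<and>
     (\<forall>p. \<eta> p (\<xi> p) = 1) \<and>
     (\<forall>X\<in>vector_fields A. \<forall>Y\<in>vector_fields A. \<forall>p.
        g p (\<phi> p (X p)) (\<phi> p (Y p)) = - g p (X p) (Y p) + \<eta> p (X p) * \<eta> p (Y p))"

definition yamabe_almost_soliton ::
    "('m, 'e::euclidean_space) chart set \<Rightarrow> ('m \<Rightarrow> 'm tvec \<Rightarrow> 'm tvec \<Rightarrow> real) \<Rightarrow>
     ('m vfield \<Rightarrow> 'm vfield \<Rightarrow> 'm vfield) \<Rightarrow> 'm vfield \<Rightarrow> ('m \<Rightarrow> real) \<Rightarrow> bool" where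
  "yamabe_almost_soliton A g D \<theta> l \<longleftrightarrow>
     \<theta> \<in> vector_fields A \<and> smooth_fun A l \<and>
     (\<forall>X\<in>vector_fields A. \<forall>Y\<in>vector_fields A. \<forall>p.
        1 / 2 * lie_derivative_metric \<theta> g X Y p =
          (scalar_curvature A g D p - l p) * g p (X p) (Y p))"

definition vertical_potential ::
    "('m, 'e::euclidean_space) chart set \<Rightarrow> 'm vfield \<Rightarrow> ('m \<Rightarrow> real) \<Rightarrow> 'm vfield \<Rightarrow> bool" where
  "vertical_potential A \<xi> k \<theta> \<longleftrightarrow> smooth_fun A k \<and> (\<forall>p. k p \<noteq> 0) \<and> \<theta> = vscale k \<xi>"

definition torse_forming ::
    "('m, 'e::euclidean_space) chart set \<Rightarrow> ('m vfield \<Rightarrow> 'm vfield \<Rightarrow> 'm vfield) \<Rightarrow>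
     'm vfield \<Rightarrow> ('m \<Rightarrow> real) \<Rightarrow> ('m \<Rightarrow> 'm tvec \<Rightarrow> real) \<Rightarrow> bool" where
  "torse_forming A D \<theta> f \<gamma> \<longleftrightarrow>
     \<theta> \<in> vector_fields A \<and> smooth_fun A f \<and> one_form A \<gamma> \<and>
     (\<forall>X\<in>vector_fields A. D X \<theta> = vadd (vscale f X) (vscale (\<lambda>p. \<gamma> p (X p)) \<theta>))"

end

theory Submission
  imports Defs
begin

text \<open>
  The Levi-Civita connection gives \<open>1/2 (L\<^sub>\<theta> g)(X, X) = g(D\<^sub>X \<theta>, X)\<close> for every vector field \<open>X\<close>,
  see \<open>lie_derivative_metric_diagonal\<close>. If \<open>\<theta> = k \<xi>\<close> is torse-forming, the right-hand side is
  \<open>f g(X, X) + \<gamma>(X) k g(\<xi>, X)\<close>, while the soliton equation says that the left-hand side is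
  \<open>(\<tau> - \<lambda>) g(X, X)\<close>. At a point where \<open>X\<close> is orthogonal to \<open>\<xi>\<close> but not null, comparing the two
  yields \<open>\<tau> - \<lambda> = f\<close>.

  Such a tangent vector exists at every point \<open>p\<close> (\<open>ex_non_null_orthogonal_to_reeb\<close>): the signature
  \<open>(n + 1, n)\<close> with \<open>n \<ge> 1\<close> provides a unit vector \<open>e\<close> with \<open>g(e, e) = -1\<close>, and since \<open>\<xi>\<close> satisfies
  \<open>g(\<xi>, \<xi>) = 1\<close>, the orthogonal projection of \<open>e\<close> along \<open>\<xi>\<close> is even more negative.

  The soliton equation speaks of global smooth vector fields, so this tangent vector has to be the
  value of one (\<open>tangent_vector_extends_to_field\<close>). Most of the work goes into this extension. The
  coordinate derivatives of a chart around \<open>p\<close>, multiplied by a smooth bump function, are global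
  vector fields, and a bump function times a coordinate function shows that their values at \<open>p\<close>
  depend injectively on the direction \<open>v\<close> in the model space \<open>'e\<close>. Since an orthonormal frame spans the
  space of derivations at \<open>p\<close> by \<open>DIM('e)\<close> vectors, injectivity implies surjectivity, and every
  derivation at \<open>p\<close> is such a value. Counting dimensions in this way replaces the usual argument
  by Hadamard's lemma that derivations are directional derivatives.
\<close>

section \<open>Calculus of \<open>C\<^sup>k\<close> maps\<close>

lemma C_k_on_cong:
  assumes "open S" "\<And>x. x \<in> S \<Longrightarrow> f x = g x"
  shows "C_k_on k S f \<longleftrightarrow> C_k_on k S g"
  using assms(2)
proof (induction k arbitrary: f g)
  case 0
  then show ?case by (simp cong: continuous_on_cong)
next
  case (Suc k)
  have iff: "(f has_derivative f') (at x) \<longleftrightarrow> (g has_derivative f') (at x)" if "x \<in> S" for x f'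
    using has_derivative_transform_within_open[OF _ \<open>open S\<close> that, of f f' UNIV g]
      has_derivative_transform_within_open[OF _ \<open>open S\<close> that, of g f' UNIV f] Suc.prems
    by auto
  have "frechet_derivative f (at x) = frechet_derivative g (at x)" if "x \<in> S" for x
    unfolding frechet_derivative_def using iff[OF that] by simp
  then have "C_k_on k S (\<lambda>x. frechet_derivative f (at x) v)
      \<longleftrightarrow> C_k_on k S (\<lambda>x. frechet_derivative g (at x) v)" for v
    by (intro Suc.IH) auto
  with iff show ?case by (auto simp: differentiable_def)
qed

text \<open>Any family of derivatives may serve in place of \<open>frechet_derivative\<close>; this turns the
  differentiation rules into closure properties of the class \<open>C\<^sup>k\<close>.\<close>

lemma C_k_on_SucI:
  assumes "open S" "\<And>x. x \<in> S \<Longrightarrow> (f has_derivative f' x) (at x)"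
    and "\<And>v. C_k_on k S (\<lambda>x. f' x v)"
  shows "C_k_on (Suc k) S f"
proof -
  have "C_k_on k S (\<lambda>x. frechet_derivative f (at x) v) \<longleftrightarrow> C_k_on k S (\<lambda>x. f' x v)" for v
    by (intro C_k_on_cong assms(1)) (metis assms(2) frechet_derivative_at)
  with assms show ?thesis by (auto simp: differentiable_def)
qed

lemma C_k_on_SucD:
  assumes "C_k_on (Suc k) S f" "x \<in> S"
  shows "(f has_derivative frechet_derivative f (at x)) (at x)"
  using assms frechet_derivative_works by auto

lemma C_k_on_mono: "C_k_on k S f \<Longrightarrow> T \<subseteq> S \<Longrightarrow> C_k_on k T f"
  by (induction k arbitrary: f) (auto intro: continuous_on_subset)

lemma C_k_on_local:
  assumes "\<And>x. x \<in> S \<Longrightarrow> \<exists>T. open T \<and> x \<in> T \<and> C_k_on k T f"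
  shows "C_k_on k S f"
  using assms
proof (induction k arbitrary: f)
  case 0
  have "continuous (at x) f" if "x \<in> S" for x
    using 0[OF that] by (auto simp: continuous_on_eq_continuous_at)
  then show ?case by (simp add: continuous_at_imp_continuous_on)
next
  case (Suc k)
  have "C_k_on k S (\<lambda>x. frechet_derivative f (at x) v)" for v
    by (intro Suc.IH) (use Suc.prems in fastforce)
  then show ?case using Suc.prems by fastforce
qed

lemma C_k_on_Suc_imp: "C_k_on (Suc k) S f \<Longrightarrow> C_k_on k S f"
  by (induction k arbitrary: f)
    (auto intro: continuous_at_imp_continuous_on differentiable_imp_continuous_within)

lemma C_k_on_const: "open S \<Longrightarrow> C_k_on k S (\<lambda>x. c)"
  by (induction k arbitrary: c) (auto intro!: C_k_on_SucI[where f' = "\<lambda>x v. 0"] simp del: C_k_on.simps(2))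

lemma C_k_on_bounded_linear:
  assumes "bounded_linear L" "open S" "C_k_on k S f"
  shows "C_k_on k S (\<lambda>x. L (f x))"
  using assms(3)
proof (induction k arbitrary: f)
  case 0
  then show ?case using assms(1) by (auto intro: bounded_linear.continuous_on)
next
  case (Suc k)
  show ?case
    using bounded_linear.has_derivative[OF assms(1) C_k_on_SucD[OF Suc.prems]] Suc.prems
    by (intro C_k_on_SucI[OF assms(2), where f' = "\<lambda>x v. L (frechet_derivative f (at x) v)"])
      (auto intro: Suc.IH)
qed

lemma C_k_on_ident: "open S \<Longrightarrow> C_k_on k S (\<lambda>x. x)"
  by (cases k) (auto intro!: C_k_on_SucI[where f' = "\<lambda>x v. v"] C_k_on_const simp del: C_k_on.simps(2))

lemma C_k_on_add:
  assumes "open S" "C_k_on k S f" "C_k_on k S g"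
  shows "C_k_on k S (\<lambda>x. f x + g x)"
  using assms(2,3)
proof (induction k arbitrary: f g)
  case 0
  then show ?case by (auto intro: continuous_on_add)
next
  case (Suc k)
  show ?case
    using has_derivative_add[OF C_k_on_SucD[OF Suc.prems(1)] C_k_on_SucD[OF Suc.prems(2)]] Suc.prems
    by (intro C_k_on_SucI[OF assms(1),
          where f' = "\<lambda>x v. frechet_derivative f (at x) v + frechet_derivative g (at x) v"])
      (auto intro: Suc.IH)
qed

lemma C_k_on_sum:
  assumes "open S" "\<And>i. i \<in> I \<Longrightarrow> C_k_on k S (f i)"
  shows "C_k_on k S (\<lambda>x. \<Sum>i\<in>I. f i x)"
  using assms(2)
  by (induction I rule: infinite_finite_induct) (auto intro: C_k_on_const C_k_on_add assms(1))

lemma C_k_on_mult: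
  fixes f g :: "'a::real_normed_vector \<Rightarrow> real"
  assumes "open S" "C_k_on k S f" "C_k_on k S g"
  shows "C_k_on k S (\<lambda>x. f x * g x)"
  using assms(2,3)
proof (induction k arbitrary: f g)
  case 0
  then show ?case by (auto intro: continuous_on_mult)
next
  case (Suc k)
  note fg = C_k_on_Suc_imp[OF Suc.prems(1)] C_k_on_Suc_imp[OF Suc.prems(2)]
  let ?d = "\<lambda>x v. f x * frechet_derivative g (at x) v + frechet_derivative f (at x) v * g x"
  have "C_k_on k S (\<lambda>x. ?d x v)" for v
    using Suc.prems by (intro C_k_on_add[OF assms(1)] Suc.IH fg) auto
  moreover have "((\<lambda>x. f x * g x) has_derivative ?d x) (at x)" if "x \<in> S" for x
    by (rule has_derivative_mult[OF C_k_on_SucD[OF Suc.prems(1) that] C_k_on_SucD[OF Suc.prems(2) that]])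
  ultimately show ?case by (intro C_k_on_SucI[OF assms(1)])
qed

text \<open>Differentiability of order \<open>k\<close> is expressed by directional derivatives in fixed directions,
  whereas the chain rule differentiates \<open>g\<close> in the direction \<open>Df(x) v\<close>, which varies with \<open>x\<close>.
  Expanding that direction in the basis of the intermediate space gives sums of products, to which
  the induction hypothesis applies.\<close>

lemma C_k_on_compose:
  fixes f :: "'a::real_normed_vector \<Rightarrow> 'b::euclidean_space" and g :: "'b \<Rightarrow> real"
  assumes "open S" "open T" "f ` S \<subseteq> T" "C_k_on k S f" "C_k_on k T g"
  shows "C_k_on k S (\<lambda>x. g (f x))"
  using assms(4,5)
proof (induction k arbitrary: g)
  case 0
  then show ?case using assms(3) by (auto intro: continuous_on_compose2)
next
  case (Suc k)
  let ?f' = "\<lambda>x. frechet_derivative f (at x)" and ?g' = "\<lambda>y. frechet_derivative g (at y)"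
  have deriv: "((\<lambda>x. g (f x)) has_derivative (\<lambda>v. \<Sum>b\<in>Basis. (?f' x v \<bullet> b) * ?g' (f x) b)) (at x)"
    if "x \<in> S" for x
  proof -
    have g': "(g has_derivative ?g' (f x)) (at (f x))"
      using C_k_on_SucD[OF Suc.prems(2)] assms(3) that by auto
    have lin: "linear (?g' (f x))"
      using g' has_derivative_linear by blast
    have expand: "?g' (f x) w = (\<Sum>b\<in>Basis. (w \<bullet> b) * ?g' (f x) b)" for w
    proof -
      have "?g' (f x) w = ?g' (f x) (\<Sum>b\<in>Basis. (w \<bullet> b) *\<^sub>R b)"
        by (simp add: euclidean_representation)
      also have "\<dots> = (\<Sum>b\<in>Basis. (w \<bullet> b) * ?g' (f x) b)"
        by (simp add: linear_sum[OF lin] linear_cmul[OF lin])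
      finally show ?thesis .
    qed
    show ?thesis
      by (rule has_derivative_eq_rhs[OF has_derivative_compose[OF C_k_on_SucD[OF Suc.prems(1) that] g']])
        (rule ext, rule expand)
  qed
  have "C_k_on k S (\<lambda>x. \<Sum>b\<in>Basis. (?f' x v \<bullet> b) * ?g' (f x) b)" for v
    using Suc.prems C_k_on_Suc_imp[OF Suc.prems(1)]
    by (intro C_k_on_sum C_k_on_mult C_k_on_bounded_linear[OF bounded_linear_inner_left] Suc.IH assms(1))
      auto
  with deriv show ?case by (intro C_k_on_SucI[OF assms(1)]) auto
qed

section \<open>Bump functions\<close>

text \<open>For \<open>x > 0\<close> this is \<open>exp (-1/x) / x^m\<close>. The member \<open>m = 0\<close> is the standard smooth function that is
  flat at \<open>0\<close>; the other members make the linear span closed under differentiation.\<close>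

definition flat :: "nat \<Rightarrow> real \<Rightarrow> real" where
  "flat m x = (if x > 0 then inverse x ^ m * exp (- inverse x) else 0)"

lemma flat_tendsto_0: "(flat m \<longlongrightarrow> 0) (at 0)"
proof -
  \<comment> \<open>In the variable \<open>t = 1/x\<close> this says that \<open>exp\<close> dominates powers at infinity.\<close>
  have "((\<lambda>x. inverse x ^ m / exp (inverse x)) \<longlongrightarrow> (0::real)) (at_right 0)"
    by (rule filterlim_compose[OF tendsto_power_div_exp_0 filterlim_inverse_at_top_right])
  then have "(flat m \<longlongrightarrow> 0) (at_right 0)"
    by (rule Lim_transform_eventually)
      (auto simp: flat_def eventually_at_filter exp_minus divide_inverse intro: always_eventually)
  moreover have "(flat m \<longlongrightarrow> 0) (at_left 0)"
    by (rule Lim_transform_eventually[OF tendsto_const])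
      (auto simp: flat_def eventually_at_filter intro: always_eventually)
  ultimately show ?thesis by (simp add: filterlim_split_at)
qed

lemma flat_has_derivative:
  "(flat m has_real_derivative flat (m + 2) x - m * flat (m + 1) x) (at x)"
proof -
  consider "x > 0" | "x < 0" | "x = 0" by linarith
  then show ?thesis
  proof cases
    case 1
    have power: "((\<lambda>x. inverse x ^ m) has_real_derivative - m * inverse x ^ (m + 1)) (at x)"
    proof (cases m)
      case (Suc j)
      have "((\<lambda>x. inverse x) has_real_derivative - (inverse x * inverse x)) (at x)"
        using 1 by (auto intro!: derivative_eq_intros)
      from DERIV_power_Suc[OF this, of j] show ?thesis
        by (simp add: Suc algebra_simps)
    qed simp
    have "((\<lambda>x. inverse x ^ m * exp (- inverse x)) has_real_derivative
        flat (m + 2) x - m * flat (m + 1) x) (at x)"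
      by (rule derivative_eq_intros power refl)+
        (use 1 in \<open>auto simp: flat_def power2_eq_square algebra_simps\<close>)
    then show ?thesis
      by (rule has_field_derivative_transform_within_open[where S = "{0<..}"])
        (use 1 in \<open>auto simp: flat_def\<close>)
  next
    case 2
    have "((\<lambda>x. 0) has_real_derivative flat (m + 2) x - m * flat (m + 1) x) (at x)"
      using 2 by (simp add: flat_def)
    then show ?thesis
      by (rule has_field_derivative_transform_within_open[where S = "{..<0}"])
        (use 2 in \<open>auto simp: flat_def\<close>)
  next
    case 3
    \<comment> \<open>The difference quotient at \<open>0\<close> is the next member of the family.\<close>
    have "(\<lambda>h. (flat m (0 + h) - flat m 0) / h) = flat (Suc m)"
      by (auto simp: flat_def field_simps)
    then show ?thesis
      using flat_tendsto_0[of "Suc m"] 3 by (simp add: DERIV_def flat_def)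
  qed
qed

lemma C_k_on_flat: "C_k_on k UNIV (flat m)"
proof (induction k arbitrary: m)
  case 0
  show ?case using flat_has_derivative
    by (auto intro!: continuous_at_imp_continuous_on DERIV_isCont)
next
  case (Suc k)
  have "C_k_on k UNIV (\<lambda>x. (flat (m + 2) x + (- real m) * flat (m + 1) x) * v)" for v
    by (intro C_k_on_mult C_k_on_add C_k_on_const Suc.IH open_UNIV)
  moreover have "(flat m has_derivative (\<lambda>v. (flat (m + 2) x + (- real m) * flat (m + 1) x) * v)) (at x)" for x
    using flat_has_derivative[of m x] by (simp add: has_field_derivative_def)
  ultimately show ?case by (intro C_k_on_SucI) auto
qed

lemma smooth_bump:
  fixes a :: "'e::euclidean_space"
  assumes "r > 0"
  shows "\<exists>\<beta> :: 'e \<Rightarrow> real. smooth_on UNIV \<beta> \<and> \<beta> a > 0 \<and> (\<forall>x. x \<notin> cball a r \<longrightarrow> \<beta> x = 0)"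
proof (intro exI conjI allI impI)
  define d :: "'e \<Rightarrow> real" where "d x = r\<^sup>2 - (x - a) \<bullet> (x - a)" for x
  have d_alt: "d = (\<lambda>x. r\<^sup>2 + (-1) * (\<Sum>b\<in>Basis. ((x + (- a)) \<bullet> b) * ((x + (- a)) \<bullet> b)))"
    unfolding d_def by (rule ext, subst euclidean_inner) simp
  have "C_k_on k UNIV d" for k
    unfolding d_alt
    by (intro C_k_on_add C_k_on_sum C_k_on_mult C_k_on_const C_k_on_ident
        C_k_on_bounded_linear[OF bounded_linear_inner_left] open_UNIV)
  then show "smooth_on UNIV (\<lambda>x. flat 0 (d x))"
    unfolding smooth_on_def by (auto intro!: C_k_on_compose[OF _ open_UNIV _ _ C_k_on_flat])
  show "flat 0 (d a) > 0" using assms by (simp add: d_def flat_def)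
  show "flat 0 (d x) = 0" if "x \<notin> cball a r" for x
  proof -
    have "r\<^sup>2 \<le> (norm (x - a))\<^sup>2"
      using that assms by (intro power_mono) (auto simp: dist_norm norm_minus_commute)
    then show ?thesis by (simp add: flat_def d_def power2_norm_eq_inner)
  qed
qed

section \<open>Smooth functions on a manifold\<close>

lemma smooth_manifoldD:
  assumes "smooth_manifold A" "(U, \<psi>) \<in> A"
  shows "open U" "open (\<psi> ` U)" "homeomorphism U (\<psi> ` U) \<psi> (inv_into U \<psi>)"
  using assms unfolding smooth_manifold_def by blast+

lemma smooth_manifold_transitionD:
  assumes "smooth_manifold A" "(U, \<psi>) \<in> A" "(V, \<rho>) \<in> A"
  shows "C_k_on k (\<psi> ` (U \<inter> V)) (\<rho> \<circ> inv_into U \<psi>)"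
  using assms unfolding smooth_manifold_def smooth_on_def by blast

lemma smooth_funD:
  "smooth_fun A f \<Longrightarrow> (U, \<psi>) \<in> A \<Longrightarrow> C_k_on k (\<psi> ` U) (\<lambda>x. f (inv_into U \<psi> x))"
  unfolding smooth_fun_def smooth_on_def o_def by blast

lemma smooth_funI:
  "(\<And>U \<psi> k. (U, \<psi>) \<in> A \<Longrightarrow> C_k_on k (\<psi> ` U) (\<lambda>x. f (inv_into U \<psi> x))) \<Longrightarrow> smooth_fun A f"
  unfolding smooth_fun_def smooth_on_def o_def by blast

lemma smooth_fun_lincomb:
  assumes "smooth_manifold A" "smooth_fun A f" "smooth_fun A h"
  shows "smooth_fun A (\<lambda>q. a * f q + b * h q)"
  by (intro smooth_funI C_k_on_add C_k_on_mult C_k_on_const)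
    (auto intro: smooth_manifoldD(2) assms smooth_funD)

lemma smooth_fun_mult:
  assumes "smooth_manifold A" "smooth_fun A f" "smooth_fun A h"
  shows "smooth_fun A (\<lambda>q. f q * h q)"
  by (intro smooth_funI C_k_on_mult) (auto intro: smooth_manifoldD(2) assms smooth_funD)

text \<open>Here the Hausdorff property enters: the compact support is closed in the whole manifold, so that
  each chart domain is covered by the two open sets on which the function is a composition of smooth
  maps, respectively zero.\<close>

lemma smooth_fun_extend_by_zero:
  fixes A :: "('m::{t2_space, second_countable_topology}, 'e::euclidean_space) chart set"
  assumes mf: "smooth_manifold A" and U: "(U, \<psi>) \<in> A"
    and u: "smooth_on (\<psi> ` U) u" and C: "compact C" "C \<subseteq> \<psi> ` U"
    and vanish: "\<And>x. x \<notin> C \<Longrightarrow> u x = 0"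
  shows "smooth_fun A (\<lambda>q. if q \<in> U then u (\<psi> q) else 0)" (is "smooth_fun A ?h")
proof (rule smooth_funI)
  fix V \<rho> k assume V: "(V, \<rho>) \<in> A"
  note oU = smooth_manifoldD(1,2)[OF mf U] and hU = smooth_manifoldD(3)[OF mf U]
    and oV = smooth_manifoldD(1,2)[OF mf V] and hV = smooth_manifoldD(3)[OF mf V]
    and trans = smooth_manifold_transitionD[OF mf V U, of k]
  have open_image: "open (\<rho> ` W)" if "open W" "W \<subseteq> V" for W
  proof -
    have "openin (top_of_set V) W" using that by (simp add: openin_open_eq oV)
    from homeomorphism_imp_open_map[OF hV this] show ?thesis by (simp add: openin_open_eq oV)
  qed
  have inv: "inv_into V \<rho> (\<rho> q) = q" if "q \<in> V" for q
    using homeomorphism_apply1[OF hV that] .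
  have injU: "inv_into U \<psi> (\<psi> q) = q" if "q \<in> U" for q
    using homeomorphism_apply1[OF hU that] .
  define K where "K = inv_into U \<psi> ` C"
  have "compact K"
    unfolding K_def
    by (intro compact_continuous_image C continuous_on_subset[OF homeomorphism_cont2[OF hU]])
  then have oVK: "open (V - K)" using oV by (intro open_Diff compact_imp_closed)
  have off: "?h q = 0" if "q \<notin> K" for q
  proof (cases "q \<in> U")
    case True
    then have "\<psi> q \<notin> C" using that injU unfolding K_def by (metis image_eqI)
    then show ?thesis using vanish by simp
  qed simp
  have "\<exists>T. open T \<and> x \<in> T \<and> C_k_on k T (\<lambda>x. ?h (inv_into V \<rho> x))" if x: "x \<in> \<rho> ` V" for x
  proof -
    obtain q where q: "q \<in> V" "x = \<rho> q" using x by auto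
    show ?thesis
    proof (cases "q \<in> U")
      case True
      have o: "open (\<rho> ` (V \<inter> U))" using oV oU by (intro open_image) auto
      have "C_k_on k (\<rho> ` (V \<inter> U)) (\<lambda>x. u ((\<psi> \<circ> inv_into V \<rho>) x))"
      proof (rule C_k_on_compose[OF o oU(2) _ trans])
        show "(\<psi> \<circ> inv_into V \<rho>) ` \<rho> ` (V \<inter> U) \<subseteq> \<psi> ` U" using inv by auto
        show "C_k_on k (\<psi> ` U) u" using u by (simp add: smooth_on_def)
      qed
      then have "C_k_on k (\<rho> ` (V \<inter> U)) (\<lambda>x. ?h (inv_into V \<rho> x))"
        by (rule C_k_on_cong[OF o, THEN iffD1, rotated]) (use inv in auto)
      then show ?thesis using o q True by blast
    next
      case False
      have o: "open (\<rho> ` (V - K))" using oVK by (intro open_image) auto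
      have "C_k_on k (\<rho> ` (V - K)) (\<lambda>x. ?h (inv_into V \<rho> x))"
      proof (rule C_k_on_cong[OF o, THEN iffD1])
        show "0 = ?h (inv_into V \<rho> x)" if x: "x \<in> \<rho> ` (V - K)" for x
        proof -
          obtain q where "q \<in> V" "q \<notin> K" "x = \<rho> q" using x by auto
          then show ?thesis using off[of q] inv[of q] by (simp split: if_splits)
        qed
      qed (rule C_k_on_const[OF o])
      moreover have "q \<notin> K"
        using False C(2) homeomorphism_image2[OF hU] unfolding K_def by blast
      ultimately show ?thesis using o q by blast
    qed
  qed
  then show "C_k_on k (\<rho> ` V) (\<lambda>x. ?h (inv_into V \<rho> x))" by (rule C_k_on_local)
qed

section \<open>Extension of tangent vectors to vector fields\<close>

text \<open>The directional derivative along \<open>v\<close> in the chart \<open>c\<close>, cut off by \<open>\<beta>\<close>. The value on functions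
  that are not smooth is the one prescribed for tangent vectors.\<close>

definition bump_coordinate_field ::
    "('m, 'e::euclidean_space) chart set \<Rightarrow> ('m, 'e) chart \<Rightarrow> ('e \<Rightarrow> real) \<Rightarrow> 'e \<Rightarrow> 'm vfield" where
  "bump_coordinate_field A c \<beta> v = (\<lambda>q h. if q \<in> fst c \<and> smooth_fun A h
     then \<beta> (snd c q) * frechet_derivative (\<lambda>x. h (inv_into (fst c) (snd c) x)) (at (snd c q)) v
     else 0)"

lemma smooth_fun_chart_derivative:
  assumes "smooth_manifold A" "(U, \<psi>) \<in> A" "smooth_fun A h" "q \<in> U"
  shows "((\<lambda>x. h (inv_into U \<psi> x)) has_derivative
    frechet_derivative (\<lambda>x. h (inv_into U \<psi> x)) (at (\<psi> q))) (at (\<psi> q))"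
  using C_k_on_SucD[OF smooth_funD[OF assms(3,2)]] assms(4) by blast

lemma bump_coordinate_field_in_vector_fields:
  fixes A :: "('m::{t2_space, second_countable_topology}, 'e::euclidean_space) chart set"
  assumes mf: "smooth_manifold A" and U: "(U, \<psi>) \<in> A"
    and \<beta>: "smooth_on UNIV \<beta>" and C: "compact C" "C \<subseteq> \<psi> ` U"
    and vanish: "\<And>x. x \<notin> C \<Longrightarrow> \<beta> x = 0"
  shows "bump_coordinate_field A (U, \<psi>) \<beta> v \<in> vector_fields A" (is "?X \<in> _")
  unfolding vector_fields_def
proof (intro CollectI conjI allI impI)
  fix q
  have inv: "inv_into U \<psi> (\<psi> q) = q" if "q \<in> U"
    using homeomorphism_apply1[OF smooth_manifoldD(3)[OF mf U] that] .
  have lin: "?X q (\<lambda>q. a * f q + b * h q) = a * ?X q f + b * ?X q h"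
    if f: "smooth_fun A f" and h: "smooth_fun A h" for f h a b
  proof (cases "q \<in> U")
    case True
    have "((\<lambda>x. a * f (inv_into U \<psi> x) + b * h (inv_into U \<psi> x)) has_derivative
       (\<lambda>v. a * frechet_derivative (\<lambda>x. f (inv_into U \<psi> x)) (at (\<psi> q)) v
          + b * frechet_derivative (\<lambda>x. h (inv_into U \<psi> x)) (at (\<psi> q)) v)) (at (\<psi> q))"
      by (intro has_derivative_add has_derivative_mult_right smooth_fun_chart_derivative[OF mf U] f h True)
    from frechet_derivative_at[OF this, symmetric] show ?thesis
      using True smooth_fun_lincomb[OF mf f h, of a b] f h
      by (simp add: bump_coordinate_field_def algebra_simps)
  qed (simp add: bump_coordinate_field_def)
  have prod: "?X q (\<lambda>q. f q * h q) = f q * ?X q h + h q * ?X q f"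
    if f: "smooth_fun A f" and h: "smooth_fun A h" for f h
  proof (cases "q \<in> U")
    case True
    have "((\<lambda>x. f (inv_into U \<psi> x) * h (inv_into U \<psi> x)) has_derivative
       (\<lambda>v. f (inv_into U \<psi> (\<psi> q)) * frechet_derivative (\<lambda>x. h (inv_into U \<psi> x)) (at (\<psi> q)) v
          + frechet_derivative (\<lambda>x. f (inv_into U \<psi> x)) (at (\<psi> q)) v * h (inv_into U \<psi> (\<psi> q))))
       (at (\<psi> q))"
      by (intro has_derivative_mult smooth_fun_chart_derivative[OF mf U] f h True)
    from frechet_derivative_at[OF this, symmetric] show ?thesis
      using True smooth_fun_mult[OF mf f h] f h
      by (simp add: bump_coordinate_field_def algebra_simps inv)
  qed (simp add: bump_coordinate_field_def)
  show "?X q \<in> tangent_space A q"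
    unfolding tangent_space_def
    using lin prod by (simp add: bump_coordinate_field_def)
next
  fix h assume h: "smooth_fun A h"
  note oU = smooth_manifoldD(2)[OF mf U]
  let ?d = "\<lambda>x. frechet_derivative (\<lambda>x. h (inv_into U \<psi> x)) (at x) v"
  have "smooth_on (\<psi> ` U) (\<lambda>x. \<beta> x * ?d x)"
    unfolding smooth_on_def
  proof
    fix k
    have "C_k_on k (\<psi> ` U) ?d" using smooth_funD[OF h U, of "Suc k"] by simp
    moreover have "C_k_on k (\<psi> ` U) \<beta>"
      using \<beta> unfolding smooth_on_def by (auto intro: C_k_on_mono)
    ultimately show "C_k_on k (\<psi> ` U) (\<lambda>x. \<beta> x * ?d x)" by (intro C_k_on_mult oU)
  qed
  then have "smooth_fun A (\<lambda>q. if q \<in> U then \<beta> (\<psi> q) * ?d (\<psi> q) else 0)"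
    by (rule smooth_fun_extend_by_zero[OF mf U _ C]) (simp add: vanish)
  then show "smooth_fun A (\<lambda>q. ?X q h)"
    using h by (simp add: bump_coordinate_field_def cong: if_cong)
qed

lemma bump_coordinate_field_linear:
  fixes A :: "('m::{t2_space, second_countable_topology}, 'e::euclidean_space) chart set"
  assumes mf: "smooth_manifold A" and U: "(U, \<psi>) \<in> A"
  shows "bump_coordinate_field A (U, \<psi>) \<beta> v q h
    = (\<Sum>b\<in>Basis. (v \<bullet> b) * bump_coordinate_field A (U, \<psi>) \<beta> b q h)"
proof (cases "q \<in> U \<and> smooth_fun A h")
  case True
  define d where "d = frechet_derivative (\<lambda>x. h (inv_into U \<psi> x)) (at (\<psi> q))"
  have lin: "linear d"
    unfolding d_def using smooth_fun_chart_derivative[OF mf U] True has_derivative_linear by blast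
  have "d v = d (\<Sum>b\<in>Basis. (v \<bullet> b) *\<^sub>R b)" by (simp add: euclidean_representation)
  also have "\<dots> = (\<Sum>b\<in>Basis. (v \<bullet> b) * d b)"
    by (simp add: linear_sum[OF lin] linear_cmul[OF lin])
  finally show ?thesis
    using True by (simp add: bump_coordinate_field_def d_def[symmetric] sum_distrib_left mult.left_commute)
qed (auto simp: bump_coordinate_field_def)

text \<open>The fields are tested on functions that are globally smooth, so the coordinate function
  \<open>\<langle>x - \<psi>(p), b\<rangle>\<close> is cut off by \<open>\<beta>\<close> as well. It vanishes at \<open>\<psi>(p)\<close>, hence the derivative of the
  product there is \<open>\<beta>(\<psi>(p)) \<langle>v, b\<rangle>\<close>, free of derivatives of \<open>\<beta>\<close>.\<close>

lemma bump_coordinate_field_detects: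
  fixes A :: "('m::{t2_space, second_countable_topology}, 'e::euclidean_space) chart set"
  assumes mf: "smooth_manifold A" and U: "(U, \<psi>) \<in> A" "p \<in> U"
    and \<beta>: "smooth_on UNIV \<beta>" "\<beta> (\<psi> p) \<noteq> 0" and C: "compact C" "C \<subseteq> \<psi> ` U"
    and vanish: "\<And>x. x \<notin> C \<Longrightarrow> \<beta> x = 0"
    and zero: "\<And>h. bump_coordinate_field A (U, \<psi>) \<beta> v p h = 0"
  shows "v = 0"
proof (rule euclidean_eqI)
  fix b :: 'e
  define u where "u x = \<beta> x * ((x + (- \<psi> p)) \<bullet> b)" for x
  define h where "h q = (if q \<in> U then u (\<psi> q) else 0)" for q
  have \<beta>k: "C_k_on k UNIV \<beta>" for k using \<beta>(1) by (simp add: smooth_on_def)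
  have "C_k_on k UNIV u" for k
    unfolding u_def
    by (intro C_k_on_add C_k_on_mult C_k_on_const C_k_on_ident \<beta>k
        C_k_on_bounded_linear[OF bounded_linear_inner_left] open_UNIV)
  then have "smooth_on (\<psi> ` U) u"
    unfolding smooth_on_def by (auto intro: C_k_on_mono)
  then have h: "smooth_fun A h"
    unfolding h_def by (rule smooth_fun_extend_by_zero[OF mf U(1) _ C]) (simp add: u_def vanish)
  have "(\<beta> has_derivative frechet_derivative \<beta> (at (\<psi> p))) (at (\<psi> p))"
    by (rule C_k_on_SucD[OF \<beta>k]) simp
  then have "(u has_derivative (\<lambda>v. \<beta> (\<psi> p) * (v \<bullet> b))) (at (\<psi> p))"
    unfolding u_def by (auto intro!: derivative_eq_intros)
  then have "((\<lambda>x. h (inv_into U \<psi> x)) has_derivative (\<lambda>v. \<beta> (\<psi> p) * (v \<bullet> b))) (at (\<psi> p))"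
  proof (rule has_derivative_transform_within_open)
    show "open (\<psi> ` U)" "\<psi> p \<in> \<psi> ` U" using smooth_manifoldD(2)[OF mf U(1)] U(2) by auto
    show "u x = h (inv_into U \<psi> x)" if "x \<in> \<psi> ` U" for x
      using that homeomorphism_apply1[OF smooth_manifoldD(3)[OF mf U(1)]] by (auto simp: h_def)
  qed
  then have "bump_coordinate_field A (U, \<psi>) \<beta> v p h = \<beta> (\<psi> p) * (\<beta> (\<psi> p) * (v \<bullet> b))"
    using h U(2) by (simp add: bump_coordinate_field_def frechet_derivative_at[symmetric])
  then show "v \<bullet> b = 0 \<bullet> b" using zero[of h] \<beta>(2) by simp
qed

text \<open>If \<open>DIM('e)\<close> vectors span the derivations at \<open>p\<close>, then the injective linear map from directions
  in \<open>'e\<close> to values at \<open>p\<close> of cut-off coordinate fields is onto.\<close>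

lemma tangent_vector_extends_to_field:
  fixes A :: "('m::{t2_space, second_countable_topology}, 'e::euclidean_space) chart set"
  assumes mf: "smooth_manifold A"
    and span: "\<And>v. v \<in> tangent_space A p \<Longrightarrow> \<exists>c. v = (\<lambda>f. \<Sum>i<DIM('e). c i * e i f)"
    and w: "w \<in> tangent_space A p"
  shows "\<exists>X\<in>vector_fields A. X p = w"
proof -
  have "p \<in> (\<Union>(U, \<psi>)\<in>A. U)" using mf by (simp add: smooth_manifold_def)
  then obtain U \<psi> where U: "(U, \<psi>) \<in> A" "p \<in> U" by blast
  obtain r where r: "r > 0" "cball (\<psi> p) r \<subseteq> \<psi> ` U"
    using smooth_manifoldD(2)[OF mf U(1)] U(2) open_contains_cball by (metis image_eqI)
  obtain \<beta> :: "'e \<Rightarrow> real" where \<beta>: "smooth_on UNIV \<beta>" "\<beta> (\<psi> p) > 0"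
    "\<And>x. x \<notin> cball (\<psi> p) r \<Longrightarrow> \<beta> x = 0"
    using smooth_bump[OF r(1), of "\<psi> p"] by blast
  define X where "X = bump_coordinate_field A (U, \<psi>) \<beta>"
  have X: "X v \<in> vector_fields A" for v
    unfolding X_def
    by (rule bump_coordinate_field_in_vector_fields[OF mf U(1) \<beta>(1) compact_cball r(2) \<beta>(3)])
  then have "\<exists>c. X v p = (\<lambda>f. \<Sum>i<DIM('e). c i * e i f)" for v
    by (intro span) (auto simp: vector_fields_def)
  then obtain c where c: "X v p = (\<lambda>f. \<Sum>i<DIM('e). c v i * e i f)" for v by metis
  obtain B where B: "bij_betw B {..<DIM('e)} (Basis :: 'e set)"
    using ex_bij_betw_nat_finite[OF finite_Basis] by (auto simp: atLeast0LessThan)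
  have B_inner: "B i \<bullet> B j = (if i = j then 1 else 0)" if "i < DIM('e)" "j < DIM('e)" for i j
  proof -
    have "B i \<in> Basis" "B j \<in> Basis" using bij_betwE[OF B] that by auto
    moreover have "B i = B j \<longleftrightarrow> i = j"
      using inj_on_eq_iff[OF bij_betw_imp_inj_on[OF B]] that by auto
    ultimately show ?thesis by (simp add: inner_Basis)
  qed
  have sum_inner: "(\<Sum>i<DIM('e). d i *\<^sub>R B i) \<bullet> B j = d j" if "j < DIM('e)" for d j
  proof -
    have "(\<Sum>i<DIM('e). d i *\<^sub>R B i) \<bullet> B j = (\<Sum>i<DIM('e). if i = j then d i else 0)"
      unfolding inner_sum_left by (intro sum.cong) (use that B_inner in auto)
    then show ?thesis using that by simp
  qed
  \<comment> \<open>Derivations form no type of class \<open>real_vector\<close>. Their coefficients are therefore stored in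
    the model space, where the comparison of injectivity and surjectivity is available.\<close>
  define L where "L v = (\<Sum>b\<in>Basis. (v \<bullet> b) *\<^sub>R (\<Sum>i<DIM('e). c b i *\<^sub>R B i))" for v :: 'e
  have lin: "linear L"
    by (rule linearI)
      (simp_all add: L_def inner_add_left scaleR_add_left sum.distrib scaleR_sum_right[of _ _ Basis])
  have X_L: "X v p f = (\<Sum>i<DIM('e). (L v \<bullet> B i) * e i f)" for v f
  proof -
    have "X v p f = (\<Sum>b\<in>Basis. (v \<bullet> b) * X b p f)"
      unfolding X_def by (rule bump_coordinate_field_linear[OF mf U(1)])
    also have "\<dots> = (\<Sum>b\<in>Basis. \<Sum>i<DIM('e). (v \<bullet> b) * c b i * e i f)"
      by (simp add: c sum_distrib_left mult.assoc)
    also have "\<dots> = (\<Sum>i<DIM('e). \<Sum>b\<in>Basis. (v \<bullet> b) * c b i * e i f)"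
      by (rule sum.swap)
    also have "\<dots> = (\<Sum>i<DIM('e). (L v \<bullet> B i) * e i f)"
      by (intro sum.cong refl) (simp add: L_def inner_sum_left[of _ Basis] sum_inner sum_distrib_right)
    finally show ?thesis .
  qed
  have "inj L"
    unfolding linear_injective_0[OF lin]
  proof (intro allI impI)
    fix v assume "L v = 0"
    then have "bump_coordinate_field A (U, \<psi>) \<beta> v p h = 0" for h
      using X_L[of v h] by (simp add: X_def)
    then show "v = 0"
      using \<beta>(2)
      by (intro bump_coordinate_field_detects[OF mf U \<beta>(1) _ compact_cball r(2) \<beta>(3)]) auto
  qed
  then have "surj L" by (rule linear_injective_imp_surjective[OF lin _ refl])
  obtain a where a: "w = (\<lambda>f. \<Sum>i<DIM('e). a i * e i f)" using span[OF w] by blast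
  obtain v where v: "L v = (\<Sum>i<DIM('e). a i *\<^sub>R B i)" using \<open>surj L\<close> by (metis surjD)
  have "X v p f = w f" for f
    unfolding X_L v a by (intro sum.cong refl) (simp add: sum_inner)
  then show ?thesis using X by blast
qed

section \<open>Metric geometry of the Reeb field and the Lie derivative\<close>

lemma tangent_space_lincomb:
  assumes "v \<in> tangent_space A p" "w \<in> tangent_space A p"
  shows "tadd (tscale a v) (tscale b w) \<in> tangent_space A p"
  using assms by (simp add: tangent_space_def tadd_def tscale_def algebra_simps)

lemma symmetric_2_tensorD:
  assumes "symmetric_2_tensor A g" "v \<in> tangent_space A p" "w \<in> tangent_space A p"
    "z \<in> tangent_space A p"
  shows "g p v w = g p w v"
    and "g p (tadd (tscale a v) (tscale b w)) z = a * g p v z + b * g p w z"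
    and "g p z (tadd (tscale a v) (tscale b w)) = a * g p z v + b * g p z w"
proof -
  show sym: "g p v w = g p w v" using assms by (simp add: symmetric_2_tensor_def)
  show lin: "g p (tadd (tscale a v) (tscale b w)) z = a * g p v z + b * g p w z"
    using assms by (simp add: symmetric_2_tensor_def)
  have "g p z (tadd (tscale a v) (tscale b w)) = g p (tadd (tscale a v) (tscale b w)) z"
    using assms(1,4) tangent_space_lincomb[OF assms(2,3)] unfolding symmetric_2_tensor_def by blast
  also have "\<dots> = a * g p z v + b * g p z w"
    using assms lin by (simp add: symmetric_2_tensor_def)
  finally show "g p z (tadd (tscale a v) (tscale b w)) = a * g p z v + b * g p z w" .
qed

text \<open>This is the compatibility of \<open>g\<close> and \<open>\<phi>\<close> on the pair \<open>(\<xi>, \<xi>)\<close>, as \<open>\<phi> \<xi> = 0\<close>.\<close>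

lemma reeb_unit:
  assumes acc: "accR_manifold A n \<phi> \<xi> \<eta> g"
  shows "g p (\<xi> p) (\<xi> p) = 1"
proof -
  have \<xi>: "\<xi> \<in> vector_fields A" and g: "symmetric_2_tensor A g"
    using acc by (auto simp: accR_manifold_def pseudo_riemannian_metric_def)
  then have T: "\<xi> p \<in> tangent_space A p" by (simp add: vector_fields_def)
  have zero: "tadd (tscale 0 (\<xi> p)) (tscale 0 (\<xi> p)) = tzero"
    by (simp add: tadd_def tscale_def tzero_def)
  have T0: "tzero \<in> tangent_space A p" using tangent_space_lincomb[OF T T, of 0 0] zero by simp
  have "g p tzero tzero = 0"
    using symmetric_2_tensorD(2)[OF g T T T0, of 0 0] zero by simp
  moreover have "g p (\<phi> p (\<xi> p)) (\<phi> p (\<xi> p)) = - g p (\<xi> p) (\<xi> p) + \<eta> p (\<xi> p) * \<eta> p (\<xi> p)"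
    using acc \<xi> unfolding accR_manifold_def by blast
  moreover have "\<phi> p (\<xi> p) = tzero" "\<eta> p (\<xi> p) = 1"
    using acc unfolding accR_manifold_def by blast+
  ultimately show ?thesis by simp
qed

text \<open>For a frame vector \<open>e\<close> with \<open>g(e, e) = -1\<close> and \<open>s = g(\<xi>, e)\<close>, the vector \<open>e - s \<xi>\<close> is orthogonal
  to \<open>\<xi>\<close> and has square \<open>-1 - s\<^sup>2\<close>.\<close>

lemma ex_non_null_orthogonal_to_reeb:
  fixes A :: "('m::{t2_space, second_countable_topology}, 'e::euclidean_space) chart set"
  assumes acc: "accR_manifold A n \<phi> \<xi> \<eta> g"
  shows "\<exists>w\<in>tangent_space A p. g p (\<xi> p) w = 0 \<and> g p w w < 0"
proof -
  have g: "symmetric_2_tensor A g" and T: "\<xi> p \<in> tangent_space A p"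
    using acc by (auto simp: accR_manifold_def pseudo_riemannian_metric_def vector_fields_def)
  obtain e where e: "orthonormal_frame A g p e" and
    card: "card {i. i < DIM('e) \<and> g p (e i) (e i) = -1} = n"
    using acc unfolding accR_manifold_def pseudo_riemannian_metric_def by blast
  have "n \<noteq> 0" using acc by (auto simp: accR_manifold_def)
  then have "{i. i < DIM('e) \<and> g p (e i) (e i) = -1} \<noteq> {}" using card by (metis card.empty)
  then obtain i where i: "i < DIM('e)" "g p (e i) (e i) = -1" by blast
  have E: "e i \<in> tangent_space A p" using e i unfolding orthonormal_frame_def by blast
  define s where "s = g p (\<xi> p) (e i)"
  define w where "w = tadd (tscale 1 (e i)) (tscale (- s) (\<xi> p))"
  have W: "w \<in> tangent_space A p" unfolding w_def by (rule tangent_space_lincomb[OF E T])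
  have orth: "g p (\<xi> p) w = 0"
    unfolding w_def symmetric_2_tensorD(3)[OF g E T T] by (simp add: s_def reeb_unit[OF acc])
  have "g p w w = g p (e i) w - s * g p (\<xi> p) w"
    using symmetric_2_tensorD(2)[OF g E T W, of 1 "- s"] by (simp add: w_def[symmetric])
  also have "\<dots> = g p (e i) (e i) - s * g p (e i) (\<xi> p)"
    using symmetric_2_tensorD(3)[OF g E T E, of 1 "- s"] by (simp add: w_def[symmetric] orth)
  also have "\<dots> = -1 - s * s"
    using symmetric_2_tensorD(1)[OF g E T T] i by (simp add: s_def)
  finally have "g p w w < 0"
    using zero_le_square[of s] by linarith
  with W orth show ?thesis by blast
qed

text \<open>Metric compatibility gives \<open>V g(X, X) = 2 g(D\<^sub>V X, X)\<close>, and vanishing torsion gives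
  \<open>[V, X] = D\<^sub>V X - D\<^sub>X V\<close>; the terms with \<open>D\<^sub>V X\<close> cancel.\<close>

lemma lie_derivative_metric_diagonal:
  assumes D: "levi_civita_connection A g D" and g: "symmetric_2_tensor A g"
    and V: "V \<in> vector_fields A" and X: "X \<in> vector_fields A"
  shows "1 / 2 * lie_derivative_metric V g X X p = g p (D X V p) (X p)"
proof -
  have DVX: "D V X p \<in> tangent_space A p" and DXV: "D X V p \<in> tangent_space A p"
    and Xp: "X p \<in> tangent_space A p"
    using D V X unfolding levi_civita_connection_def affine_connection_def vector_fields_def by auto
  have "lie_bracket V X p = (\<lambda>f. D V X p f - D X V p f)"
    using D V X unfolding levi_civita_connection_def by (metis (no_types))
  then have bracket: "lie_bracket V X p = tadd (tscale 1 (D V X p)) (tscale (-1) (D X V p))"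
    by (simp add: tadd_def tscale_def)
  have "g p (X p) (lie_bracket V X p) = g p (lie_bracket V X p) (X p)"
    unfolding bracket symmetric_2_tensorD(2,3)[OF g DVX DXV Xp]
    using symmetric_2_tensorD(1)[OF g DVX Xp Xp] symmetric_2_tensorD(1)[OF g DXV Xp Xp] by simp
  moreover have "g p (lie_bracket V X p) (X p) = g p (D V X p) (X p) - g p (D X V p) (X p)"
    unfolding bracket symmetric_2_tensorD(2)[OF g DVX DXV Xp] by simp
  moreover have "V p (\<lambda>q. g q (X q) (X q)) = g p (D V X p) (X p) + g p (X p) (D V X p)"
    using D V X unfolding levi_civita_connection_def by blast
  ultimately show ?thesis
    using symmetric_2_tensorD(1)[OF g DVX Xp Xp] by (simp add: lie_derivative_metric_def)
qed

theorem theorem5p2: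
  fixes A :: "('m::{t2_space, second_countable_topology}, 'e::euclidean_space) chart set"
    and n :: nat
    and \<phi> :: "'m \<Rightarrow> 'm tvec \<Rightarrow> 'm tvec"
    and \<xi> \<theta> :: "'m vfield"
    and \<eta> \<gamma> :: "'m \<Rightarrow> 'm tvec \<Rightarrow> real"
    and g :: "'m \<Rightarrow> 'm tvec \<Rightarrow> 'm tvec \<Rightarrow> real"
    and D :: "'m vfield \<Rightarrow> 'm vfield \<Rightarrow> 'm vfield"
    and k f l :: "'m \<Rightarrow> real"
  assumes "accR_manifold A n \<phi> \<xi> \<eta> g"
    and "levi_civita_connection A g D"
    and "yamabe_almost_soliton A g D \<theta> l"
    and "vertical_potential A \<xi> k \<theta>"
    and "torse_forming A D \<theta> f \<gamma>"
  shows "\<forall>p. scalar_curvature A g D p = f p + l p"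
proof
  fix p
  have mf: "smooth_manifold A" and g: "symmetric_2_tensor A g"
    and frame: "\<exists>e. orthonormal_frame A g p e"
    and \<xi>: "\<xi> p \<in> tangent_space A p"
    using assms(1) by (auto simp: accR_manifold_def pseudo_riemannian_metric_def vector_fields_def)
  obtain w where w: "w \<in> tangent_space A p" "g p (\<xi> p) w = 0" "g p w w < 0"
    using ex_non_null_orthogonal_to_reeb[OF assms(1)] by blast
  obtain e where "orthonormal_frame A g p e" using frame by blast
  then have "\<And>v. v \<in> tangent_space A p \<Longrightarrow> \<exists>c. v = (\<lambda>f. \<Sum>i<DIM('e). c i * e i f)"
    unfolding orthonormal_frame_def by blast
  then obtain X where X: "X \<in> vector_fields A" "X p = w"
    using tangent_vector_extends_to_field[OF mf _ w(1)] by blast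
  have \<theta>: "\<theta> \<in> vector_fields A" and "D X \<theta> = vadd (vscale f X) (vscale (\<lambda>p. \<gamma> p (X p)) \<theta>)"
    using assms(5) X unfolding torse_forming_def by blast+
  moreover have "\<theta> = vscale k \<xi>" using assms(4) by (simp add: vertical_potential_def)
  ultimately have DX\<theta>: "D X \<theta> p = tadd (tscale (f p) w) (tscale (\<gamma> p w * k p) (\<xi> p))"
    by (simp add: vadd_def vscale_def tadd_def tscale_def X mult.assoc)
  have "g p (D X \<theta> p) (X p) = f p * g p w w"
    unfolding DX\<theta> using symmetric_2_tensorD(2)[OF g w(1) \<xi> w(1)] w(2) X by simp
  moreover have "1 / 2 * lie_derivative_metric \<theta> g X X p
      = (scalar_curvature A g D p - l p) * g p (X p) (X p)"
    using assms(3) X unfolding yamabe_almost_soliton_def by blast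
  ultimately have "(scalar_curvature A g D p - l p) * g p w w = f p * g p w w"
    using lie_derivative_metric_diagonal[OF assms(2) g \<theta> X(1), of p] X by simp
  then show "scalar_curvature A g D p = f p + l p" using w(3) by simp
qed

end
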